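(* Let $k\ge1$ be an integer, let $f(x)=ax^2+bx+c$ be a quadratic polynomial with integer coefficients and $a\ge 1$, and let $D=b^2-4ac$. Then, as $n\to\infty$, $$\log \mathrm{lcm}_{0\le i\le k}\{f(n+i)\}=C_{k,D}\log n+o(\log n),$$ where $C_{k,D}=2(k+1)$ if $D\ne a^2i^2$ for all integers $i$ with $1\le i\le k$, and $C_{k,D}=k+i_0+1$ if $D=a^2i_0^2$ for some integer $i_0$ with $1\le i_0\le k$.
   Context: Here $n$ runs over positive integers, and $\mathrm{lcm}_{0\le i\le k}\{f(n+i)\}$ is the (positive) least common multiple of the integers $f(n),f(n+1),\dots,f(n+k)$, which are all nonzero for $n$ sufficiently large. *)

theory Defs
  imports Complex_Main "HOL-Computational_Algebra.Polynomial" "HOL-Library.Landau_Symbols"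
begin

end

theory Submission
  imports Defs "HOL-Real_Asymp.Real_Asymp"
begin

text \<open>
  The least common multiple of finitely many nonzero integers whose pairwise gcds are bounded agrees
  with the absolute value of their product up to a bounded factor. Every common divisor of \<open>f(x)\<close>
  and \<open>f(x + m)\<close> divides \<open>m\<^sup>2 (a\<^sup>2 m\<^sup>2 - D)\<close>; when this never
  vanishes for \<open>1 \<le> m \<le> k\<close> the principle applies to the \<open>k + 1\<close> values \<open>f(n + i)\<close>, each of size
  about \<open>n\<^sup>2\<close>. If \<open>D = a\<^sup>2 i\<^sub>0\<^sup>2\<close>, then \<open>4 a f(x) = g(x) g(x + i\<^sub>0)\<close> with
  \<open>g(x) = 2 a x + b - a i\<^sub>0\<close>, and up to a bounded factor the least common multiple is that of
  the \<open>k + i\<^sub>0 + 1\<close> linear values \<open>g(n), \<dots>, g(n + k + i\<^sub>0)\<close>.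
\<close>

section \<open>Products against least common multiples\<close>

text \<open>Dividing both \<open>a * x\<close> and \<open>a * b\<close>, the left side divides
  \<open>a * gcd x b\<close>; it also divides \<open>x * gcd x b\<close>, and the gcd of these two
  is the right side.\<close>

lemma gcd_mult_dvd_mult_gcd:
  fixes x a b :: int
  shows "gcd x (a * b) dvd gcd x a * gcd x b"
proof -
  have "gcd x (a * b) dvd gcd (a * x) (a * b)"
    by simp
  then have "gcd x (a * b) dvd gcd x b * a"
    unfolding gcd_mult_distrib_int[symmetric]
    by (metis abs_dvd_iff dvd_abs_iff abs_mult abs_gcd_int mult.commute)
  then have "gcd x (a * b) dvd gcd (gcd x b * x) (gcd x b * a)"
    by simp
  then show ?thesis
    unfolding gcd_mult_distrib_int[symmetric] by (simp add: mult.commute)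
qed

lemma gcd_Lcm_le:
  fixes X :: "'i \<Rightarrow> int"
  assumes "finite J" "x \<noteq> 0" "K \<ge> 1" "\<And>j. j \<in> J \<Longrightarrow> gcd x (X j) \<le> K"
  shows "gcd x (Lcm (X ` J)) \<le> K ^ card J"
  using assms(1,4)
proof (induction J rule: finite_induct)
  case (insert j J)
  have "Lcm (X ` insert j J) dvd X j * Lcm (X ` J)"
    by simp
  then have "gcd x (Lcm (X ` insert j J)) dvd gcd x (X j * Lcm (X ` J))"
    by (meson dvd_trans gcd_dvd1 gcd_dvd2 gcd_greatest)
  also have "\<dots> dvd gcd x (X j) * gcd x (Lcm (X ` J))"
    by (rule gcd_mult_dvd_mult_gcd)
  finally have "gcd x (Lcm (X ` insert j J)) \<le> gcd x (X j) * gcd x (Lcm (X ` J))"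
    using \<open>x \<noteq> 0\<close> by (intro zdvd_imp_le) (simp_all add: zero_less_mult_iff)
  also have "\<dots> \<le> K * K ^ card J"
    using insert \<open>K \<ge> 1\<close> by (intro mult_mono) auto
  finally show ?case
    using insert by simp
qed (use assms in simp)

lemma prod_le_Lcm:
  fixes X :: "'i \<Rightarrow> int"
  assumes "finite J" "K \<ge> 1" "\<And>j. j \<in> J \<Longrightarrow> X j \<noteq> 0"
    and "\<And>i j. i \<in> J \<Longrightarrow> j \<in> J \<Longrightarrow> i \<noteq> j \<Longrightarrow> gcd (X i) (X j) \<le> K"
  shows "(\<Prod>j\<in>J. \<bar>X j\<bar>) \<le> K ^ (card J choose 2) * Lcm (X ` J)"
  using assms(1,3,4)
proof (induction J rule: finite_induct)
  case (insert i J)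
  have g: "gcd (X i) (Lcm (X ` J)) \<le> K ^ card J"
    using insert \<open>K \<ge> 1\<close> by (intro gcd_Lcm_le) auto
  have "(\<Prod>j\<in>insert i J. \<bar>X j\<bar>) = \<bar>X i\<bar> * (\<Prod>j\<in>J. \<bar>X j\<bar>)"
    using insert by simp
  also have "\<dots> \<le> \<bar>X i\<bar> * (K ^ (card J choose 2) * Lcm (X ` J))"
    using insert by (intro mult_left_mono) auto
  also have "\<dots> = K ^ (card J choose 2) * (\<bar>X i\<bar> * \<bar>Lcm (X ` J)\<bar>)"
    by simp
  also have "\<bar>X i\<bar> * \<bar>Lcm (X ` J)\<bar> = gcd (X i) (Lcm (X ` J)) * lcm (X i) (Lcm (X ` J))"
    by (simp add: prod_gcd_lcm_int)
  also have "K ^ (card J choose 2) * \<dots> \<le> K ^ (card J choose 2) * (K ^ card J * lcm (X i) (Lcm (X ` J)))"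
    using g \<open>K \<ge> 1\<close> by (intro mult_left_mono mult_right_mono) auto
  also have "\<dots> = K ^ (card (insert i J) choose 2) * Lcm (X ` insert i J)"
    using insert by (simp add: numeral_2_eq_2 power_add mult_ac)
  finally show ?case .
qed (simp add: numeral_2_eq_2)

lemma Lcm_le_prod_int:
  fixes X :: "'i \<Rightarrow> int"
  assumes "finite J" "\<And>j. j \<in> J \<Longrightarrow> X j \<noteq> 0"
  shows "Lcm (X ` J) \<le> (\<Prod>j\<in>J. \<bar>X j\<bar>)"
proof (rule zdvd_imp_le)
  show "Lcm (X ` J) dvd (\<Prod>j\<in>J. \<bar>X j\<bar>)"
  proof (rule Lcm_least)
    fix y assume "y \<in> X ` J"
    then obtain j where "j \<in> J" "y = X j"
      by blast
    then have "\<bar>y\<bar> dvd (\<Prod>j\<in>J. \<bar>X j\<bar>)"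
      using assms by (simp only:) (rule dvd_prodI)
    then show "y dvd (\<Prod>j\<in>J. \<bar>X j\<bar>)"
      by simp
  qed
  show "(\<Prod>j\<in>J. \<bar>X j\<bar>) > 0"
    using assms by (intro prod_pos) auto
qed

text \<open>The bounds \<open>h i j\<close> do not involve \<open>n\<close>, so a single constant
  serves for all \<open>n\<close>.\<close>

lemma Lcm_comparable_prod_eventually:
  fixes X :: "nat \<Rightarrow> nat \<Rightarrow> int" and h :: "nat \<Rightarrow> nat \<Rightarrow> int"
  assumes "finite J" and ev: "\<forall>\<^sub>F n in F. \<forall>j\<in>J. X n j \<noteq> 0"
    and dvd: "\<And>n i j. i \<in> J \<Longrightarrow> j \<in> J \<Longrightarrow> gcd (X n i) (X n j) dvd h i j"
    and h: "\<And>i j. i \<in> J \<Longrightarrow> j \<in> J \<Longrightarrow> i \<noteq> j \<Longrightarrow> h i j \<noteq> 0"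
  shows "\<exists>K\<ge>1. \<forall>\<^sub>F n in F. (\<Prod>j\<in>J. \<bar>X n j\<bar>) \<le> K * Lcm (X n ` J)"
proof -
  \<comment> \<open>A sum over all pairs serves as a common bound; the summand 1 keeps
    \<open>M \<ge> 1\<close> even if every \<open>h i j\<close> is 0 or \<open>J\<close> is
    empty.\<close>
  define M where "M = 1 + (\<Sum>(i,j)\<in>J \<times> J. \<bar>h i j\<bar>)"
  have M1: "M \<ge> 1"
    unfolding M_def by (simp add: sum_nonneg case_prod_unfold)
  have "gcd (X n i) (X n j) \<le> M" if "i \<in> J" "j \<in> J" "i \<noteq> j" for n i j
  proof -
    have "gcd (X n i) (X n j) \<le> \<bar>h i j\<bar>"
      using dvd[OF that(1,2), of n] h[OF that] by (intro zdvd_imp_le) auto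
    also have "\<dots> \<le> (\<Sum>(i,j)\<in>J \<times> J. \<bar>h i j\<bar>)"
      using member_le_sum[of "(i, j)" "J \<times> J" "\<lambda>(i,j). \<bar>h i j\<bar>"] that \<open>finite J\<close> by auto
    finally show ?thesis
      by (simp add: M_def)
  qed
  then have "\<forall>\<^sub>F n in F. (\<Prod>j\<in>J. \<bar>X n j\<bar>) \<le> M ^ (card J choose 2) * Lcm (X n ` J)"
    using ev by (elim eventually_mono, intro prod_le_Lcm) (use \<open>finite J\<close> M1 in auto)
  then show ?thesis
    using M1 by (intro exI[of _ "M ^ (card J choose 2)"]) simp
qed

section \<open>Passage to logarithms\<close>

text \<open>The two bounds place \<open>ln (L n)\<close> within \<open>ln K\<close> of the sum of
  the \<open>ln \<bar>X n j\<bar>\<close>, each of which is \<open>d * ln n\<close> up to a bounded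
  error. The total error is bounded, hence negligible against \<open>ln n\<close>.\<close>

lemma ln_smallo_of_comparable_prod:
  fixes X :: "nat \<Rightarrow> nat \<Rightarrow> int" and L :: "nat \<Rightarrow> int" and d :: real
  assumes ev: "\<forall>\<^sub>F n in sequentially. \<forall>j\<in>J. X n j \<noteq> 0"
    and growth: "\<And>j. j \<in> J \<Longrightarrow> (\<lambda>n. ln \<bar>real_of_int (X n j)\<bar> - d * ln (real n)) \<in> O(\<lambda>_. 1)"
    and K: "K \<ge> 1"
    and lower: "\<forall>\<^sub>F n in sequentially. (\<Prod>j\<in>J. \<bar>X n j\<bar>) \<le> K * L n"
    and upper: "\<forall>\<^sub>F n in sequentially. L n \<le> (\<Prod>j\<in>J. \<bar>X n j\<bar>)"
  shows "(\<lambda>n. ln (real_of_int (L n)) - real (card J) * d * ln (real n)) \<in> o(\<lambda>n. ln (real n))"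
proof -
  define S where "S n = (\<Sum>j\<in>J. ln \<bar>real_of_int (X n j)\<bar>)" for n
  have "\<forall>\<^sub>F n in sequentially. norm (ln (real_of_int (L n)) - S n) \<le> ln (real_of_int K) * norm (1::real)"
    using ev lower upper
  proof eventually_elim
    case (elim n)
    define P where "P = (\<Prod>j\<in>J. \<bar>X n j\<bar>)"
    have "P > 0"
      unfolding P_def using elim by (intro prod_pos) auto
    then have "K * L n > 0"
      using elim(2) by (simp add: P_def)
    then have "L n > 0"
      using K by (simp add: zero_less_mult_iff)
    \<comment> \<open>For infinite \<open>J\<close> both sides are 0, by the default values of
      \<open>prod\<close> and \<open>sum\<close>.\<close>
    have "ln (real_of_int P) = S n"
      unfolding P_def S_def of_int_prod of_int_abs using elim
      by (cases "finite J") (auto intro: ln_prod)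
    moreover have "ln (real_of_int (L n)) \<le> ln (real_of_int P)"
      using elim(3) \<open>L n > 0\<close> \<open>P > 0\<close> unfolding P_def[symmetric] by simp
    moreover have "real_of_int P \<le> real_of_int K * real_of_int (L n)"
      using elim(2) unfolding P_def by (metis of_int_le_iff of_int_mult)
    then have "ln (real_of_int P) \<le> ln (real_of_int K * real_of_int (L n))"
      using \<open>P > 0\<close> by (subst ln_le_cancel_iff) auto
    then have "ln (real_of_int P) \<le> ln (real_of_int K) + ln (real_of_int (L n))"
      using K \<open>L n > 0\<close> by (simp add: ln_mult)
    ultimately show ?case
      by simp
  qed
  then have 1: "(\<lambda>n. ln (real_of_int (L n)) - S n) \<in> O(\<lambda>_. 1)"
    by (rule bigoI)
  have "(\<lambda>n. \<Sum>j\<in>J. ln \<bar>real_of_int (X n j)\<bar> - d * ln (real n)) \<in> O(\<lambda>_. 1)"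
    using growth by (rule big_sum_in_bigo)
  then have 2: "(\<lambda>n. S n - card J * d * ln (real n)) \<in> O(\<lambda>_. 1)"
    by (simp add: S_def sum_subtractf mult.assoc)
  have "(\<lambda>n. ln (real_of_int (L n)) - card J * d * ln (real n)) \<in> O(\<lambda>_. 1)"
    using sum_in_bigo(1)[OF 1 2] by simp
  also have "(\<lambda>_. 1 :: real) \<in> o(\<lambda>n. ln (real n))"
    by real_asymp
  finally show ?thesis .
qed

section \<open>Growth and common divisors of polynomial values\<close>

lemma ln_quadratic_bigo:
  fixes a b c j :: real
  assumes "a > 0"
  shows "(\<lambda>n::nat. ln \<bar>a * (real n + j)\<^sup>2 + b * (real n + j) + c\<bar> - 2 * ln (real n)) \<in> O(\<lambda>_. 1)"
    and "\<forall>\<^sub>F n in sequentially. a * (real n + j)\<^sup>2 + b * (real n + j) + c > 0"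
proof -
  show "\<forall>\<^sub>F n in sequentially. a * (real n + j)\<^sup>2 + b * (real n + j) + c > 0"
    using assms by real_asymp
  show "(\<lambda>n::nat. ln \<bar>a * (real n + j)\<^sup>2 + b * (real n + j) + c\<bar> - 2 * ln (real n)) \<in> O(\<lambda>_. 1)"
    using assms by real_asymp
qed

lemma ln_linear_bigo:
  fixes a b :: real
  assumes "a > 0"
  shows "(\<lambda>n::nat. ln \<bar>a * real n + b\<bar> - ln (real n)) \<in> O(\<lambda>_. 1)"
    and "\<forall>\<^sub>F n in sequentially. a * real n + b > 0"
  using assms by real_asymp+

text \<open>Put \<open>u = 2 * a * x + b\<close>. The two values differ by
  \<open>m * (u + a * m)\<close>; multiplying this by \<open>m * (u - a * m)\<close> gives
  \<open>m^2 * (u^2 - a^2 * m^2)\<close>, and \<open>u^2\<close> is \<open>4 * a\<close> times the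
  first value plus the discriminant. This eliminates \<open>x\<close>.\<close>

lemma common_divisor_quadratic_shift:
  fixes a b c d m x :: int
  assumes "d dvd a * x\<^sup>2 + b * x + c" "d dvd a * (x + m)\<^sup>2 + b * (x + m) + c"
  shows "d dvd m\<^sup>2 * (a\<^sup>2 * m\<^sup>2 - (b\<^sup>2 - 4 * a * c))"
proof -
  have "m\<^sup>2 * (a\<^sup>2 * m\<^sup>2 - (b\<^sup>2 - 4 * a * c)) =
      (a * x\<^sup>2 + b * x + c) * (4 * a * m\<^sup>2) 
      - ((a * (x + m)\<^sup>2 + b * (x + m) + c) - (a * x\<^sup>2 + b * x + c)) * (m * (2 * a * x + b) - a * m\<^sup>2)"
    by algebra
  with assms show ?thesis
    by (metis dvd_diff dvd_mult2)
qed

section \<open>The two cases of the discriminant\<close>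

theorem theorem1p3:
  fixes k :: nat and a b c D :: int and f :: "int poly"
  assumes "k \<ge> 1"
    and "a \<ge> 1"
    and f_eq: "f = [:c, b, a:]"
    and D_eq: "D = b\<^sup>2 - 4 * a * c"
  shows "((\<forall>i::int. 1 \<le> i \<and> i \<le> int k \<longrightarrow> D \<noteq> a\<^sup>2 * i\<^sup>2) \<longrightarrow>
            (\<lambda>n::nat. ln (real_of_int (LCM i\<in>{0..k}. poly f (int n + int i)))
                       - 2 * (real k + 1) * ln (real n)) \<in> o(\<lambda>n. ln (real n))) \<and>
         (\<forall>i0::int. 1 \<le> i0 \<and> i0 \<le> int k \<and> D = a\<^sup>2 * i0\<^sup>2 \<longrightarrow>
            (\<lambda>n::nat. ln (real_of_int (LCM i\<in>{0..k}. poly f (int n + int i)))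
                       - (real k + real_of_int i0 + 1) * ln (real n)) \<in> o(\<lambda>n. ln (real n)))"
proof (intro conjI impI allI)
  define L where "L n = (LCM i\<in>{0..k}. poly f (int n + int i))" for n
  have f: "poly f x = a * x\<^sup>2 + b * x + c" for x
    by (simp add: f_eq power2_eq_square algebra_simps)
  have f_real: "real_of_int (poly f (int n + int i)) =
      real_of_int a * (real n + real i)\<^sup>2 + real_of_int b * (real n + real i) + real_of_int c" for n i
    by (simp add: f)
  have f_ev: "\<forall>\<^sub>F n in sequentially. \<forall>i\<in>{0..k}. poly f (int n + int i) \<noteq> 0"
  proof (intro eventually_ball_finite ballI)
    fix i
    show "\<forall>\<^sub>F n in sequentially. poly f (int n + int i) \<noteq> 0"
      using ln_quadratic_bigo(2)[of "real_of_int a" "real i" "real_of_int b" "real_of_int c"] \<open>a \<ge> 1\<close>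
      by (auto elim!: eventually_mono simp flip: f_real)
  qed simp
  {
    assume nonsplit: "\<forall>i::int. 1 \<le> i \<and> i \<le> int k \<longrightarrow> D \<noteq> a\<^sup>2 * i\<^sup>2"
    define h where "h i j = (int j - int i)\<^sup>2 * (a\<^sup>2 * (int j - int i)\<^sup>2 - D)" for i j
    have h0: "h i j \<noteq> 0" if "i \<in> {0..k}" "j \<in> {0..k}" "i \<noteq> j" for i j
      \<comment> \<open>Only squares of \<open>int j - int i\<close> occur in \<open>h\<close>, so
        the hypothesis for the positive shift covers both orders of \<open>i\<close> and
        \<open>j\<close>.\<close>
      using nonsplit[rule_format, of "\<bar>int j - int i\<bar>"] that
      by (cases "i < j") (auto simp: h_def power2_commute)
    have "gcd (poly f (int n + int i)) (poly f (int n + int j)) dvd h i j" for n i j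
      unfolding h_def D_eq
      by (rule common_divisor_quadratic_shift[where x = "int n + int i"]) (simp_all flip: f)
    then obtain K where K: "K \<ge> 1"
      "\<forall>\<^sub>F n in sequentially. (\<Prod>j\<in>{0..k}. \<bar>poly f (int n + int j)\<bar>) \<le> K * L n"
      unfolding L_def
      using Lcm_comparable_prod_eventually[of "{0..k}" "\<lambda>n j. poly f (int n + int j)" sequentially h]
        f_ev h0 by auto
    have "(\<lambda>n. ln (real_of_int (L n)) - real (card {0..k}) * 2 * ln (real n)) \<in> o(\<lambda>n. ln (real n))"
    proof (rule ln_smallo_of_comparable_prod[OF f_ev _ K])
      show "\<forall>\<^sub>F n in sequentially. L n \<le> (\<Prod>j\<in>{0..k}. \<bar>poly f (int n + int j)\<bar>)"
        unfolding L_def using f_ev by (auto elim!: eventually_mono intro!: Lcm_le_prod_int)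
      show "(\<lambda>n. ln \<bar>real_of_int (poly f (int n + int j))\<bar> - 2 * ln (real n)) \<in> O(\<lambda>_. 1)" for j
        unfolding f_real using \<open>a \<ge> 1\<close> by (intro ln_quadratic_bigo(1)) simp
    qed
    then show "(\<lambda>n. ln (real_of_int (LCM i\<in>{0..k}. poly f (int n + int i)))
        - 2 * (real k + 1) * ln (real n)) \<in> o(\<lambda>n. ln (real n))"
      by (simp add: L_def algebra_simps)
  next
    fix i0 :: int
    assume i0: "1 \<le> i0 \<and> i0 \<le> int k \<and> D = a\<^sup>2 * i0\<^sup>2"
    define m where "m = nat i0"
    have m: "i0 = int m" "1 \<le> m" "m \<le> k"
      using i0 by (auto simp: m_def)
    \<comment> \<open>The value at \<open>n + i\<close> uses the linear factors with indices
      \<open>i\<close> and \<open>i + m\<close>, so these indices run up to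
      \<open>k + m\<close>.\<close>
    define J where "J = {0..k+m}"
    \<comment> \<open>\<open>4 * a * f(x)\<close> is \<open>(2 * a * x + b)^2 - (a * i0)^2\<close>;
      the factor with \<open>+ a * i0\<close> is the one with \<open>- a * i0\<close> shifted by
      \<open>i0\<close> in \<open>x\<close>.\<close>
    define g where "g n j = 2 * a * (int n + int j) + b - a * i0" for n j
    have fg: "4 * a * poly f (int n + int i) = g n i * g n (i + m)" for n i
    proof -
      have "b\<^sup>2 - 4 * a * c = a\<^sup>2 * i0\<^sup>2"
        using i0 D_eq by simp
      then show ?thesis
        unfolding f g_def by (simp add: m(1)) algebra
    qed
    have g_real: "real_of_int (g n j) = real_of_int (2 * a) * real n +
        real_of_int (2 * a * int j + b - a * i0)" for n j
      by (simp add: g_def algebra_simps)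
    have g_ev: "\<forall>\<^sub>F n in sequentially. \<forall>j\<in>J. g n j \<noteq> 0"
    proof (intro eventually_ball_finite ballI)
      fix j
      have "\<forall>\<^sub>F n in sequentially. real_of_int (g n j) > 0"
        unfolding g_real using \<open>a \<ge> 1\<close> by (intro ln_linear_bigo(2)) simp
      then show "\<forall>\<^sub>F n in sequentially. g n j \<noteq> 0"
        by (rule eventually_mono) simp
    qed (simp add: J_def)
    have "gcd (g n i) (g n j) dvd 2 * a * (int j - int i)" for n i j
    proof -
      have "2 * a * (int j - int i) = g n j - g n i"
        by (simp add: g_def algebra_simps)
      then show ?thesis
        by (simp add: dvd_diff)
    qed
    then obtain K where K: "K \<ge> 1"
      "\<forall>\<^sub>F n in sequentially. (\<Prod>j\<in>J. \<bar>g n j\<bar>) \<le> K * Lcm (g n ` J)"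
      using Lcm_comparable_prod_eventually[of J g sequentially "\<lambda>i j. 2 * a * (int j - int i)"]
        g_ev \<open>a \<ge> 1\<close> by (auto simp: J_def)
    \<comment> \<open>The factor \<open>4 * a\<close> enters because \<open>g n j\<close> is only
      known to divide \<open>4 * a\<close> times a value of \<open>f\<close>.\<close>
    have lower: "\<forall>\<^sub>F n in sequentially. (\<Prod>j\<in>J. \<bar>g n j\<bar>) \<le> (K * (4 * a)) * L n"
      using K(2) f_ev
    proof eventually_elim
      case (elim n)
      have "L n \<noteq> 0"
        unfolding L_def using elim(2) by (subst Lcm_0_iff) auto
      then have "L n > 0"
        using Lcm_int_greater_eq_0[of "(\<lambda>i. poly f (int n + int i)) ` {0..k}"] unfolding L_def by linarith
      have "Lcm (g n ` J) dvd 4 * a * L n"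
      proof (rule Lcm_least, safe)
        fix j assume "j \<in> J"
        \<comment> \<open>Take \<open>i = j\<close> if \<open>j \<le> k\<close> and
          \<open>i = j - m\<close> otherwise. As \<open>m \<le> k\<close>, no index between
          \<open>k\<close> and \<open>m\<close> is left uncovered.\<close>
        then obtain i where "i \<le> k" "i = j \<or> i + m = j"
          using m unfolding J_def by (metis atLeastAtMost_iff le_add_diff_inverse2 le_diff_conv nle_le order_trans)
        then have "g n j dvd 4 * a * poly f (int n + int i)"
          unfolding fg by auto
        also have "\<dots> dvd 4 * a * L n"
          unfolding L_def using \<open>i \<le> k\<close> by (intro mult_dvd_mono dvd_Lcm) auto
        finally show "g n j dvd 4 * a * L n" .
      qed
      then have "Lcm (g n ` J) \<le> 4 * a * L n"
        using \<open>L n > 0\<close> \<open>a \<ge> 1\<close> by (intro zdvd_imp_le) auto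
      then have "K * Lcm (g n ` J) \<le> K * (4 * a * L n)"
        using K(1) by (intro mult_left_mono) auto
      then show ?case
        using elim(1) by (simp add: mult.assoc)
    qed
    have upper: "\<forall>\<^sub>F n in sequentially. L n \<le> (\<Prod>j\<in>J. \<bar>g n j\<bar>)"
      using g_ev
    proof eventually_elim
      case (elim n)
      show ?case
      proof (rule zdvd_imp_le)
        show "(\<Prod>j\<in>J. \<bar>g n j\<bar>) > 0"
          using elim by (intro prod_pos) auto
        show "L n dvd (\<Prod>j\<in>J. \<bar>g n j\<bar>)"
          unfolding L_def
        proof (rule Lcm_least, safe)
          fix i assume "i \<in> {0..k}"
          \<comment> \<open>As \<open>m \<ge> 1\<close>, the two indices are distinct, so both
            factors of \<open>4 * a * f(n + i)\<close> occur separately in the product over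
            \<open>J\<close>; the upper bound needs no constant.\<close>
          then have "{i, i + m} \<subseteq> J"
            using m by (auto simp: J_def)
          then have "(\<Prod>j\<in>{i, i + m}. \<bar>g n j\<bar>) dvd (\<Prod>j\<in>J. \<bar>g n j\<bar>)"
            by (intro prod_dvd_prod_subset) (auto simp: J_def)
          moreover have "(\<Prod>j\<in>{i, i + m}. \<bar>g n j\<bar>) = \<bar>4 * a * poly f (int n + int i)\<bar>"
            using m(2) unfolding fg by (simp add: abs_mult)
          ultimately show "poly f (int n + int i) dvd (\<Prod>j\<in>J. \<bar>g n j\<bar>)"
            by (metis abs_dvd_iff dvd_mult_right)
        qed
      qed
    qed
    have K': "K * (4 * a) \<ge> 1"
      using K(1) \<open>a \<ge> 1\<close> by (simp add: int_one_le_iff_zero_less)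
    have "(\<lambda>n. ln \<bar>real_of_int (g n j)\<bar> - 1 * ln (real n)) \<in> O(\<lambda>_. 1)" for j
      unfolding g_real mult_1 using \<open>a \<ge> 1\<close> by (intro ln_linear_bigo(1)) simp
    then have "(\<lambda>n. ln (real_of_int (L n)) - real (card J) * 1 * ln (real n)) \<in> o(\<lambda>n. ln (real n))"
      by (rule ln_smallo_of_comparable_prod[OF g_ev _ K' lower upper])
    then show "(\<lambda>n. ln (real_of_int (LCM i\<in>{0..k}. poly f (int n + int i)))
        - (real k + real_of_int i0 + 1) * ln (real n)) \<in> o(\<lambda>n. ln (real n))"
      by (simp add: L_def J_def m(1) algebra_simps)
  }
qed

end
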